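(* Let $v$ be a vertex of a graph $G$. If the neighbor set $N_G(v)$ of $v$ is a minimal vertex cover of $G$, then $I_c(G\setminus v)$ is normal if and only if $I_c(G)$ is normal.
   Context: Graphs are finite, with no multiple edges or loops. The vertices of $G$, $V(G)=\{t_1,\ldots,t_s\}$, are regarded as variables of the polynomial ring $S=K[t_1,\ldots,t_s]$ over a field $K$. $N_G(v)$ is the set of vertices adjacent to $v$, and $G\setminus v$ is the graph obtained from $G$ by deleting $v$ and all edges containing $v$. A vertex cover is a set of vertices meeting every edge; it is minimal if minimal with respect to inclusion. The ideal of covers $I_c(G)$ is generated by all squarefree monomials $\prod_{t_i\in C}t_i$ with $C$ a minimal vertex cover of $G$; if $G$ has no edges, $I_c(G)$ is the whole ring. An ideal $J$ is normal if $J^n=\overline{J^n}$ for all $n\geq 1$, where $\overline{J^n}$ is the integral closure of $J^n$. *)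

theory Defs
  imports
    "Graph_Theory.Digraph"
    "HOL-Library.Poly_Mapping"
    "HOL-Algebra.Ideal_Product"
begin

text \<open>
  Finite simple graphs are rendered by the locale predicate \<^const>\<open>graph\<close>: finite, loop-free
  symmetric digraphs without multiple arcs, so that an undirected edge is a pair of opposite arcs.
\<close>

definition neighbors :: "('v, 'e) pre_digraph \<Rightarrow> 'v \<Rightarrow> 'v set" where
  "neighbors G v = {u \<in> verts G. v \<rightarrow>\<^bsub>G\<^esub> u}"

definition vertex_cover :: "('v, 'e) pre_digraph \<Rightarrow> 'v set \<Rightarrow> bool" where
  "vertex_cover G C \<longleftrightarrow> C \<subseteq> verts G \<and> (\<forall>e\<in>arcs G. tail G e \<in> C \<or> head G e \<in> C)"

definition minimal_vertex_cover :: "('v, 'e) pre_digraph \<Rightarrow> 'v set \<Rightarrow> bool" where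
  "minimal_vertex_cover G C \<longleftrightarrow> vertex_cover G C \<and> (\<forall>D. D \<subset> C \<longrightarrow> \<not> vertex_cover G D)"

text \<open>
  A multivariate polynomial maps exponent vectors to coefficients. The type contains the polynomials
  in all variables of type \<^typ>\<open>'v\<close>; the ring $K[V]$ consists of those in which only variables
  from $V$ occur.
\<close>

type_synonym ('v, 'k) mvpoly = "('v \<Rightarrow>\<^sub>0 nat) \<Rightarrow>\<^sub>0 'k"

definition var :: "'v \<Rightarrow> ('v, 'k::field) mvpoly" where
  "var t = Poly_Mapping.single (Poly_Mapping.single t 1) 1"

definition poly_ring :: "'v set \<Rightarrow> ('v, 'k::field) mvpoly ring" where
  "poly_ring V =
    \<lparr>carrier = {p. \<forall>m\<in>Poly_Mapping.keys p. Poly_Mapping.keys m \<subseteq> V},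
     mult = (*), one = 1, zero = 0, add = (+)\<rparr>"

text \<open>
  The integral closure of an ideal $I$ of $R$: all $x \in R$ satisfying an equation
  $x^n + a_1 x^{n-1} + \cdots + a_n = 0$ with $n \geq 1$ and $a_i \in I^i$. Powers of ideals are
  powers in the semiring \<^const>\<open>ideals_set\<close>, whose multiplication is the product of ideals.
\<close>

definition integral_closure :: "('a, 'b) ring_scheme \<Rightarrow> 'a set \<Rightarrow> 'a set" where
  "integral_closure R I =
    {x \<in> carrier R. \<exists>n a. 1 \<le> (n::nat) \<and>
       (\<forall>i\<in>{1..n}. a i \<in> I [^]\<^bsub>ideals_set R\<^esub> i) \<and>
       x [^]\<^bsub>R\<^esub> n \<oplus>\<^bsub>R\<^esub> (\<Oplus>\<^bsub>R\<^esub>i\<in>{1..n}. a i \<otimes>\<^bsub>R\<^esub> x [^]\<^bsub>R\<^esub> (n - i)) = \<zero>\<^bsub>R\<^esub>}"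

definition normal_ideal :: "('a, 'b) ring_scheme \<Rightarrow> 'a set \<Rightarrow> bool" where
  "normal_ideal R J \<longleftrightarrow>
    (\<forall>n::nat. 1 \<le> n \<longrightarrow> J [^]\<^bsub>ideals_set R\<^esub> n = integral_closure R (J [^]\<^bsub>ideals_set R\<^esub> n))"

text \<open>
  If \<open>G\<close> has no edges, its only minimal vertex cover is empty and contributes the empty product,
  so that the ideal of covers is the whole ring; see \<open>cover_ideal_edgeless\<close>.
\<close>

definition cover_ideal :: "('v, 'e) pre_digraph \<Rightarrow> ('v, 'k::field) mvpoly set" where
  "cover_ideal G = Idl\<^bsub>poly_ring (verts G)\<^esub> {\<Prod>t\<in>C. var t |C. minimal_vertex_cover G C}"

lemma cring_poly_ring: "cring (poly_ring V :: ('v, 'k::field) mvpoly ring)"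
proof (rule cringI)
  let ?R = "poly_ring V :: ('v, 'k) mvpoly ring"
  have add: "p + q \<in> carrier ?R" if "p \<in> carrier ?R" "q \<in> carrier ?R" for p q
    using that Poly_Mapping.keys_add[of p q] unfolding poly_ring_def by fastforce
  have mult: "p * q \<in> carrier ?R" if "p \<in> carrier ?R" "q \<in> carrier ?R" for p q
  proof -
    have "Poly_Mapping.keys m \<subseteq> V" if m: "m \<in> Poly_Mapping.keys (p * q)" for m
    proof -
      obtain a b where ab: "m = a + b" "a \<in> Poly_Mapping.keys p" "b \<in> Poly_Mapping.keys q"
        using m keys_mult[of p q] by blast
      then show ?thesis
        using \<open>p \<in> carrier ?R\<close> \<open>q \<in> carrier ?R\<close> Poly_Mapping.keys_add[of a b]
        unfolding poly_ring_def by fastforce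
    qed
    then show ?thesis unfolding poly_ring_def by simp
  qed
  show "abelian_group ?R"
  proof (rule abelian_groupI)
    fix p assume p: "p \<in> carrier ?R"
    then have "- p \<in> carrier ?R" by (simp add: poly_ring_def)
    moreover have "- p \<oplus>\<^bsub>?R\<^esub> p = \<zero>\<^bsub>?R\<^esub>" by (simp add: poly_ring_def)
    ultimately show "\<exists>q\<in>carrier ?R. q \<oplus>\<^bsub>?R\<^esub> p = \<zero>\<^bsub>?R\<^esub>" by blast
  next
    fix p q assume "p \<in> carrier ?R" "q \<in> carrier ?R"
    from add[OF this] show "p \<oplus>\<^bsub>?R\<^esub> q \<in> carrier ?R" by (simp add: poly_ring_def)
  qed (simp_all add: poly_ring_def add_ac)
  show "comm_monoid ?R"
  proof (rule comm_monoidI)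
    fix p q assume "p \<in> carrier ?R" "q \<in> carrier ?R"
    from mult[OF this] show "p \<otimes>\<^bsub>?R\<^esub> q \<in> carrier ?R" by (simp add: poly_ring_def)
  qed (simp_all add: poly_ring_def mult_ac)
qed (simp add: poly_ring_def distrib_right)

lemma cover_ideal_edgeless:
  assumes "arcs G = {}"
  shows "cover_ideal G = carrier (poly_ring (verts G) :: ('v, 'k::field) mvpoly ring)"
proof -
  let ?R = "poly_ring (verts G) :: ('v, 'k) mvpoly ring"
  interpret R: cring ?R by (rule cring_poly_ring)
  have "minimal_vertex_cover G C \<longleftrightarrow> C = {}" for C
    using assms unfolding minimal_vertex_cover_def vertex_cover_def by auto
  then have "{\<Prod>t\<in>C. var t |C. minimal_vertex_cover G C} = {\<one>\<^bsub>?R\<^esub>}"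
    by (simp add: poly_ring_def)
  then show ?thesis
    unfolding cover_ideal_def by (simp only: R.genideal_one)
qed

end

theory Submission
  imports Defs Complex_Main "HOL-Library.Multiset"
begin

text \<open>
  Let $N$ be the set of neighbours of $v$ and $f = \prod_{u\in N} u$. A vertex cover of $G$ that avoids
  $v$ contains $N$. As $N$ is itself a cover, the minimal covers of $G$ are $N$ and the sets
  $D\cup\{v\}$ for minimal covers $D\neq N$ of $G\setminus v$. With $J=I_c(G\setminus v)$
  this gives $I_c(G) = vJ + (f)$. Moreover $f\in J$, since $N$ also covers $G\setminus v$.
  (If $N$ is minimal in $G\setminus v$, the product $vf$ lies in $(f)$ anyway.)

  The rest holds for every monomial ideal $J$ and every monomial $f\in J$ in which $v$ does not occur.
  Put $I=vJ+(f)$. Since $f\in J$, the ideals $f^{n-i}J^i$ increase with $i$, so the coefficient of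
  $v^b$ in $I^n$ ranges over $f^{n-c}J^c$ with $c=\min(b,n)$ (\<open>power_component\<close>). A monomial ideal is
  normal iff $m^k\in J^{nk}$ implies $m\in J^n$ for all monomials $m$ and all $n,k\geq 1$
  (\<open>normal_monomial_ideal_iff\<close>). If $J$ is normal and $(pv^b)^k\in I^{nk}$, then
  $p^k\in f^{k(n-c)}J^{kc}$; cancelling $f^{n-c}$ from $p$ leaves a monomial of $J^c$, so that
  $pv^b\in I^n$. Conversely, if $p^k\in J^{nk}$, then $(pv^n)^k\in I^{nk}$, hence $pv^n\in I^n$, and this
  says $p\in J^n$.

  The substance of the monomial criterion is that the integral closure of a monomial ideal $I$
  contains no polynomial $x$ outside $I$ when the criterion holds. An integral equation of degree
  $d$ puts $x^N$ into $I^{N-d}$ for every $N$, and this survives subtracting from $x$ the terms that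
  lie in $I$. If something is left, let $m$ be its monomial whose exponent vector has the largest
  Euclidean norm. Such a vector is not a mean of other exponent vectors that occur, so
  $m^N$ has a nonzero coefficient in the $N$-th power and $m^N\in I^{N-d}$ for all $N$. By
  Dickson's lemma two of these memberships, at $N<N'$, are witnessed by products of
  generators one of which divides the other; their quotient shows $m^{N'-N}\in I^{N'-N}$. The
  criterion then yields $m\in I$, which is absurd.
\<close>

section \<open>Sequences of vectors of natural numbers\<close>

lemma nat_sequence_has_incseq_subsequence:
  fixes g :: "nat \<Rightarrow> nat"
  shows "\<exists>r. strict_mono r \<and> incseq (\<lambda>i. g (r i))"
proof -
  obtain f where f: "strict_mono f" "monoseq (\<lambda>i. g (f i))"
    using seq_monosub[of g] by auto
  show ?thesis
  proof (cases "incseq (\<lambda>i. g (f i))")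
    case True
    then show ?thesis using f by blast
  next
    case False
    then have dec: "decseq (\<lambda>i. g (f i))"
      using f(2) by (simp add: monoseq_iff)
    obtain i0 where i0: "\<And>j. g (f i0) \<le> g (f j)"
      using ex_has_least_nat[of "\<lambda>_. True" _ "\<lambda>i. g (f i)"] by blast
    have "g (f (i0 + j)) = g (f i0)" for j
      using i0[of "i0 + j"] decseqD[OF dec, of i0 "i0 + j"] by simp
    moreover have "strict_mono (\<lambda>j. f (i0 + j))"
      using f(1) by (simp add: strict_mono_def)
    ultimately show ?thesis
      by (intro exI[of _ "\<lambda>j. f (i0 + j)"]) (simp add: incseq_def)
  qed
qed

lemma finite_family_has_common_incseq_subsequence:
  fixes a :: "nat \<Rightarrow> 'x \<Rightarrow> nat"
  assumes "finite X"
  shows "\<exists>r. strict_mono r \<and> (\<forall>x\<in>X. incseq (\<lambda>i. a (r i) x))"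
  using assms
proof (induction X)
  case empty
  show ?case by (intro exI[of _ id]) (simp add: strict_mono_def)
next
  case (insert y X)
  obtain r where r: "strict_mono r" "\<And>x. x \<in> X \<Longrightarrow> incseq (\<lambda>i. a (r i) x)"
    using insert.IH by blast
  obtain s where s: "strict_mono s" "incseq (\<lambda>i. a (r (s i)) y)"
    using nat_sequence_has_incseq_subsequence[of "\<lambda>i. a (r i) y"] by blast
  have "incseq (\<lambda>i. a (r (s i)) x)" if "x \<in> X" for x
    using r(2)[OF that] strict_mono_mono[OF s(1)] by (simp add: incseq_def monoD)
  then show ?case
    using r(1) s by (intro exI[of _ "\<lambda>i. r (s i)"]) (auto simp: strict_mono_def)
qed

text \<open>
  Dickson's lemma: thinning out the sequence one coordinate at a time makes all coordinates
  monotone at once, since every sequence of natural numbers has a nondecreasing subsequence.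
\<close>

lemma dickson_increasing_pair:
  fixes a :: "nat \<Rightarrow> 'x \<Rightarrow> nat"
  assumes "finite X"
  obtains i j where "i < j" "\<And>x. x \<in> X \<Longrightarrow> a i x \<le> a j x"
proof -
  obtain r where r: "strict_mono r" "\<And>x. x \<in> X \<Longrightarrow> incseq (\<lambda>i. a (r i) x)"
    using finite_family_has_common_incseq_subsequence[OF assms, of a] by blast
  show ?thesis
    using that[of "r 0" "r 1"] r by (simp add: strict_mono_less incseq_def)
qed

section \<open>Exponent vectors and the powers of a monomial ideal\<close>

definition exponents :: "'v set \<Rightarrow> ('v \<Rightarrow>\<^sub>0 nat) set" where
  "exponents V = {m. Poly_Mapping.keys m \<subseteq> V}"

text \<open>
  The exponent vector of the \<open>k\<close>-th power of a monomial.
\<close>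

definition scale :: "nat \<Rightarrow> ('v \<Rightarrow>\<^sub>0 nat) \<Rightarrow> ('v \<Rightarrow>\<^sub>0 nat)" where
  "scale k m = Poly_Mapping.map ((*) k) m"

lemma lookup_scale [simp]: "Poly_Mapping.lookup (scale k m) t = k * Poly_Mapping.lookup m t"
  unfolding scale_def by (simp add: Poly_Mapping.map.rep_eq when_def)

lemma exponents_iff: "m \<in> exponents V \<longleftrightarrow> (\<forall>t. t \<notin> V \<longrightarrow> Poly_Mapping.lookup m t = 0)"
  unfolding exponents_def by (auto simp: in_keys_iff)

lemma zero_in_exponents [simp]: "0 \<in> exponents V"
  by (simp add: exponents_iff)

lemma exponents_add_iff [simp]:
  "m + m' \<in> exponents V \<longleftrightarrow> m \<in> exponents V \<and> m' \<in> exponents V"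
  by (auto simp: exponents_iff lookup_add)

lemma scale_in_exponents [simp]: "m \<in> exponents V \<Longrightarrow> scale k m \<in> exponents V"
  by (simp add: exponents_iff)

lemma single_in_exponents [simp]: "v \<in> V \<Longrightarrow> Poly_Mapping.single v b \<in> exponents V"
  by (auto simp: exponents_iff lookup_single when_def)

lemma sum_mset_in_exponents: "set_mset M \<subseteq> exponents V \<Longrightarrow> \<Sum>\<^sub># M \<in> exponents V"
  by (induction M) auto

lemma scale_0 [simp]: "scale 0 m = 0"
  and scale_1 [simp]: "scale (Suc 0) m = m"
  and scale_Suc: "scale (Suc k) m = m + scale k m"
  and scale_add_left: "scale (k + l) m = scale k m + scale l m"
  and scale_add_right: "scale k (m + m') = scale k m + scale k m'"
  and scale_scale: "scale k (scale l m) = scale (k * l) m"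
  and scale_single: "scale k (Poly_Mapping.single v b) = Poly_Mapping.single v (k * b)"
  by (rule poly_mapping_eqI; simp add: lookup_add lookup_single when_def algebra_simps)+

text \<open>
  Exponent vectors of the monomials in $K[V]$ that lie in the \<open>n\<close>-th power of the ideal generated by
  the monomials with exponents in \<open>A\<close>. The multiset \<open>M\<close> records which generators are used and
  how often, which is the data that Dickson's lemma is applied to.
\<close>

definition sums_above :: "'v set \<Rightarrow> ('v \<Rightarrow>\<^sub>0 nat) set \<Rightarrow> nat \<Rightarrow> ('v \<Rightarrow>\<^sub>0 nat) set" where
  "sums_above V A n =
    {m \<in> exponents V. \<exists>M s. set_mset M \<subseteq> A \<and> size M = n \<and> m = \<Sum>\<^sub># M + s}"

lemma sums_aboveI:
  "set_mset M \<subseteq> A \<Longrightarrow> size M = n \<Longrightarrow> \<Sum>\<^sub># M + s \<in> exponents V \<Longrightarrow> \<Sum>\<^sub># M + s \<in> sums_above V A n"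
  unfolding sums_above_def by blast

lemma sums_aboveE:
  assumes "m \<in> sums_above V A n"
  obtains M s where "set_mset M \<subseteq> A" "size M = n" "m = \<Sum>\<^sub># M + s"
    "\<Sum>\<^sub># M \<in> exponents V" "s \<in> exponents V"
  using assms unfolding sums_above_def by fastforce

lemma sums_above_in_exponents: "m \<in> sums_above V A n \<Longrightarrow> m \<in> exponents V"
  unfolding sums_above_def by blast

lemma sums_above_0 [simp]: "sums_above V A 0 = exponents V"
  unfolding sums_above_def by auto

lemma sums_above_upward_closed:
  assumes "m \<in> sums_above V A n" "s \<in> exponents V"
  shows "m + s \<in> sums_above V A n"
proof -
  obtain M s' where "set_mset M \<subseteq> A" "size M = n" "m = \<Sum>\<^sub># M + s'"
    using assms(1) by (rule sums_aboveE)
  then show ?thesis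
    using sums_aboveI[of M A n "s' + s" V] assms sums_above_in_exponents[OF assms(1)]
    by (simp add: add.assoc)
qed

lemma sums_above_add:
  assumes "m \<in> sums_above V A n" "m' \<in> sums_above V A k"
  shows "m + m' \<in> sums_above V A (n + k)"
proof -
  obtain M s where M: "set_mset M \<subseteq> A" "size M = n" "m = \<Sum>\<^sub># M + s"
    using assms(1) by (rule sums_aboveE)
  obtain M' s' where M': "set_mset M' \<subseteq> A" "size M' = k" "m' = \<Sum>\<^sub># M' + s'"
    using assms(2) by (rule sums_aboveE)
  have "m + m' = \<Sum>\<^sub># (M + M') + (s + s')"
    using M M' by (simp add: ac_simps)
  moreover have "m + m' \<in> exponents V"
    using assms by (simp add: sums_above_in_exponents)
  ultimately show ?thesis
    using sums_aboveI[of "M + M'" A "n + k" "s + s'" V] M M' by simp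
qed

lemma sums_above_scale:
  assumes "m \<in> sums_above V A 1"
  shows "scale k m \<in> sums_above V A k"
proof (induction k)
  case (Suc k)
  then show ?case using sums_above_add[OF assms Suc] by (simp add: scale_Suc)
qed simp

lemma sums_above_split:
  assumes "m \<in> sums_above V A (n + k)"
  obtains m1 m2 where "m1 \<in> sums_above V A n" "m2 \<in> sums_above V A k" "m = m1 + m2"
proof -
  obtain M s where M: "set_mset M \<subseteq> A" "size M = n + k" "m = \<Sum>\<^sub># M + s"
      "\<Sum>\<^sub># M \<in> exponents V" "s \<in> exponents V"
    using assms by (rule sums_aboveE)
  obtain xs where xs: "mset xs = M" using ex_mset by blast
  define M1 M2 where "M1 = mset (take n xs)" and "M2 = mset (drop n xs)"
  have eq: "M = M1 + M2"
    unfolding M1_def M2_def xs[symmetric] by (metis append_take_drop_id mset_append)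
  have "length xs = n + k" using xs M(2) by (metis size_mset)
  then have "size M1 = n" "size M2 = k"
    by (simp_all add: M1_def M2_def)
  moreover have "set_mset M1 \<subseteq> A" "set_mset M2 \<subseteq> A" using M(1) eq by auto
  moreover have "\<Sum>\<^sub># M1 + s \<in> exponents V" "\<Sum>\<^sub># M2 + 0 \<in> exponents V"
    using M(4,5) eq by auto
  ultimately have "\<Sum>\<^sub># M1 + s \<in> sums_above V A n" "\<Sum>\<^sub># M2 + 0 \<in> sums_above V A k"
    by (blast intro: sums_aboveI)+
  moreover have "m = (\<Sum>\<^sub># M1 + s) + (\<Sum>\<^sub># M2 + 0)"
    using M(3) eq by (simp add: ac_simps)
  ultimately show ?thesis using that by blast
qed

lemma sums_above_antimono:
  assumes "k \<le> n"
  shows "sums_above V A n \<subseteq> sums_above V A k"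
proof
  fix m assume "m \<in> sums_above V A n"
  then have "m \<in> sums_above V A (k + (n - k))" using assms by simp
  then obtain m1 m2 where "m1 \<in> sums_above V A k" "m2 \<in> sums_above V A (n - k)" "m = m1 + m2"
    by (rule sums_above_split)
  then show "m \<in> sums_above V A k"
    by (simp add: sums_above_upward_closed sums_above_in_exponents)
qed

text \<open>
  A defect of \<open>d\<close> factors, the same for all \<open>N\<close>, can be removed: write the \<open>N\<close>-th multiple of \<open>m\<close> as
  a sum of generators plus a remainder. Two of these representations are comparable in the
  multiplicities of the generators and in the remainder, and their difference represents a multiple
  of \<open>m\<close> without any defect.
\<close>

lemma multiple_in_power_if_almost_in_powers:
  assumes "finite V" "finite A" "A \<subseteq> exponents V"
    and almost: "\<And>N. d \<le> N \<Longrightarrow> scale N m \<in> sums_above V A (n * (N - d))"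
  shows "\<exists>k\<ge>1. scale k m \<in> sums_above V A (n * k)"
proof -
  have "\<exists>M s. set_mset M \<subseteq> A \<and> size M = n * i \<and> scale (d + i) m = \<Sum>\<^sub># M + s \<and> s \<in> exponents V"
    for i
  proof -
    have "scale (d + i) m \<in> sums_above V A (n * i)" using almost[of "d + i"] by simp
    then show ?thesis by (elim sums_aboveE) blast
  qed
  then obtain M s where M: "\<And>i. set_mset (M i) \<subseteq> A" "\<And>i. size (M i) = n * i"
      "\<And>i. scale (d + i) m = \<Sum>\<^sub># (M i) + s i" and s: "\<And>i. s i \<in> exponents V"
    by metis
  \<comment> \<open>One vector collects the multiplicities of the generators and the coordinates of the remainder.\<close>
  obtain i j where "i < j" and le:
      "\<And>x. x \<in> A <+> V \<Longrightarrow>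
        case_sum (count (M i)) (Poly_Mapping.lookup (s i)) x \<le>
        case_sum (count (M j)) (Poly_Mapping.lookup (s j)) x"
    using dickson_increasing_pair[of "A <+> V"
        "\<lambda>i. case_sum (count (M i)) (Poly_Mapping.lookup (s i))"] assms(1,2)
    by auto
  have "count (M i) x \<le> count (M j) x" for x
  proof (cases "x \<in> A")
    case True
    then show ?thesis using le[of "Inl x"] by auto
  next
    case False
    then have "x \<notin># M i" using M(1) by blast
    then show ?thesis by (simp add: not_in_iff)
  qed
  then have sub: "M i \<subseteq># M j" by (simp add: subseteq_mset_def)
  have s_le: "Poly_Mapping.lookup (s i) t \<le> Poly_Mapping.lookup (s j) t" for t
  proof (cases "t \<in> V")
    case True
    then show ?thesis using le[of "Inr t"] by auto
  next
    case False
    then show ?thesis using s[of i] by (simp add: exponents_iff)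
  qed
  have sj: "s j = s i + (s j - s i)"
    by (rule poly_mapping_eqI) (simp add: lookup_add lookup_minus s_le)
  have diff_exp: "s j - s i \<in> exponents V"
    using s[of j] by (simp add: exponents_iff lookup_minus)
  have sum_j: "\<Sum>\<^sub># (M j) = \<Sum>\<^sub># (M i) + \<Sum>\<^sub># (M j - M i)"
    using sub by (metis subset_mset.add_diff_inverse sum_mset.union)
  have "scale (d + i) m + scale (j - i) m = scale (d + j) m"
    using \<open>i < j\<close> by (simp flip: scale_add_left)
  also have "\<dots> = (\<Sum>\<^sub># (M i) + \<Sum>\<^sub># (M j - M i)) + (s i + (s j - s i))"
    using M(3)[of j] sum_j sj by metis
  also have "\<dots> = scale (d + i) m + (\<Sum>\<^sub># (M j - M i) + (s j - s i))"
    by (simp add: M(3) ac_simps)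
  finally have eq: "scale (j - i) m = \<Sum>\<^sub># (M j - M i) + (s j - s i)" by simp
  have "size (M j - M i) = n * (j - i)"
    using sub M(2) by (simp add: size_Diff_submset right_diff_distrib')
  moreover have subA: "set_mset (M j - M i) \<subseteq> A"
    using M(1)[of j] by (meson in_diffD subset_iff)
  moreover have "\<Sum>\<^sub># (M j - M i) + (s j - s i) \<in> exponents V"
    using subA diff_exp assms(3) by (simp add: sum_mset_in_exponents)
  ultimately have "scale (j - i) m \<in> sums_above V A (n * (j - i))"
    unfolding eq by (intro sums_aboveI)
  then show ?thesis using \<open>i < j\<close> by (intro exI[of _ "j - i"]) simp
qed

text \<open>
  The combinatorial form of normality: a monomial whose \<open>k\<close>-th power lies in the \<open>k\<close>-th power of
  $J^n$ already lies in $J^n$.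
\<close>

definition saturated_powers :: "'v set \<Rightarrow> ('v \<Rightarrow>\<^sub>0 nat) set \<Rightarrow> bool" where
  "saturated_powers V A \<longleftrightarrow>
    (\<forall>n m k. 1 \<le> n \<longrightarrow> m \<in> exponents V \<longrightarrow> 1 \<le> k \<longrightarrow>
      scale k m \<in> sums_above V A (n * k) \<longrightarrow> m \<in> sums_above V A n)"

section \<open>Adjoining a variable\<close>

text \<open>
  Exponent version of $I = vJ+(f)$ with $f\in J$, where \<open>A\<close> generates \<open>J\<close> and \<open>B\<close> generates \<open>I\<close>. The
  elements of $vA$ are only required to lie in \<open>I\<close>, because \<open>vf\<close> may be missing from
  a minimal set of generators.
\<close>

locale adjoined_variable =
  fixes V :: "'v set" and v :: 'v and A B :: "('v \<Rightarrow>\<^sub>0 nat) set" and f :: "'v \<Rightarrow>\<^sub>0 nat"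
  assumes v_notin: "v \<notin> V"
    and A_exponents: "A \<subseteq> exponents V"
    and f_in_power: "f \<in> sums_above V A 1"
    and f_in_B: "f \<in> B"
    and B_cases: "\<And>g. g \<in> B \<Longrightarrow> g = f \<or> (\<exists>a\<in>A. g = a + Poly_Mapping.single v 1)"
    and A_shifted: "\<And>a. a \<in> A \<Longrightarrow> a + Poly_Mapping.single v 1 \<in> sums_above (insert v V) B 1"
begin

lemma lookup_v: "m \<in> exponents V \<Longrightarrow> Poly_Mapping.lookup m v = 0"
  using v_notin by (simp add: exponents_iff)

lemma exponents_insert: "m \<in> exponents V \<Longrightarrow> m \<in> exponents (insert v V)"
  by (simp add: exponents_iff)

lemma exponents_insertE:
  assumes "m \<in> exponents (insert v V)"
  obtains p b where "p \<in> exponents V" "m = p + Poly_Mapping.single v b"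
proof
  show "Poly_Mapping.update v 0 m \<in> exponents V"
    using assms by (auto simp: exponents_iff lookup_update)
  show "m = Poly_Mapping.update v 0 m + Poly_Mapping.single v (Poly_Mapping.lookup m v)"
    by (rule poly_mapping_eqI) (simp add: lookup_add lookup_update lookup_single when_def)
qed

lemma add_single_v_eq_iff:
  assumes "p \<in> exponents V" "q \<in> exponents V"
  shows "p + Poly_Mapping.single v b = q + Poly_Mapping.single v c \<longleftrightarrow> p = q \<and> b = c"
proof
  assume eq: "p + Poly_Mapping.single v b = q + Poly_Mapping.single v c"
  then have "Poly_Mapping.lookup (p + Poly_Mapping.single v b) v =
      Poly_Mapping.lookup (q + Poly_Mapping.single v c) v" by simp
  then have "b = c" using assms by (simp add: lookup_add lookup_v)
  then show "p = q \<and> b = c" using eq by simp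
qed simp

lemma f_exponents: "f \<in> exponents V"
  using f_in_power by (rule sums_above_in_exponents)

lemma sum_mset_B:
  assumes "set_mset M \<subseteq> B"
  shows "\<exists>M' j. set_mset M' \<subseteq> A \<and> size M' = j \<and> j \<le> size M \<and>
    \<Sum>\<^sub># M = \<Sum>\<^sub># M' + scale (size M - j) f + Poly_Mapping.single v j"
  using assms
proof (induction M)
  case empty
  show ?case by (intro exI[of _ "{#}"]) simp
next
  case (add g M)
  then obtain M' j where IH: "set_mset M' \<subseteq> A" "size M' = j" "j \<le> size M"
      "\<Sum>\<^sub># M = \<Sum>\<^sub># M' + scale (size M - j) f + Poly_Mapping.single v j" by auto
  consider "g = f" | a where "a \<in> A" "g = a + Poly_Mapping.single v 1"
    using B_cases add.prems by auto
  then show ?case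
  proof cases
    case 1
    then show ?thesis using IH
      by (intro exI[of _ M'] exI[of _ j]) (simp add: Suc_diff_le scale_Suc ac_simps)
  next
    case 2
    have Suc_v: "Poly_Mapping.single v (Suc j) =
        Poly_Mapping.single v j + Poly_Mapping.single v (Suc 0)"
      by (simp flip: single_add)
    show ?thesis using IH 2
      by (intro exI[of _ "add_mset a M'"] exI[of _ "Suc j"])
        (simp add: ac_simps Suc_v)
  qed
qed

lemma sum_mset_A_shifted:
  assumes "set_mset M \<subseteq> A"
  shows "\<Sum>\<^sub># M + Poly_Mapping.single v (size M) \<in> sums_above (insert v V) B (size M)"
  using assms
proof (induction M)
  case (add a M)
  then have "(a + Poly_Mapping.single v 1) + (\<Sum>\<^sub># M + Poly_Mapping.single v (size M))
      \<in> sums_above (insert v V) B (1 + size M)"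
    by (intro sums_above_add A_shifted) auto
  moreover have "Poly_Mapping.single v (Suc (size M)) =
      Poly_Mapping.single v 1 + Poly_Mapping.single v (size M)"
    by (simp flip: single_add)
  ultimately show ?case by (simp add: ac_simps)
qed simp

text \<open>
  The monomials of $I^n$ of degree \<open>b\<close> in \<open>v\<close> are those of $v^bf^{n-c}J^c$ with $c=\min(b,n)$. A product
  of \<open>n\<close> generators of which \<open>j\<close> are divisible by \<open>v\<close> gives $f^{n-j}J^j$ with $j\leq c$, and this is
  contained in $f^{n-c}J^c$ because $f\in J$.
\<close>

lemma power_component:
  assumes p: "p \<in> exponents V"
  shows "p + Poly_Mapping.single v b \<in> sums_above (insert v V) B n \<longleftrightarrow>
    (\<exists>q\<in>sums_above V A (min b n). p = scale (n - min b n) f + q)"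
proof
  let ?c = "min b n"
  assume "p + Poly_Mapping.single v b \<in> sums_above (insert v V) B n"
  then obtain M s where M: "set_mset M \<subseteq> B" "size M = n"
      "p + Poly_Mapping.single v b = \<Sum>\<^sub># M + s" "s \<in> exponents (insert v V)"
    by (rule sums_aboveE)
  obtain M' j where M': "set_mset M' \<subseteq> A" "size M' = j" "j \<le> n"
      "\<Sum>\<^sub># M = \<Sum>\<^sub># M' + scale (n - j) f + Poly_Mapping.single v j"
    using sum_mset_B[OF M(1)] M(2) by blast
  obtain s' d where s': "s' \<in> exponents V" "s = s' + Poly_Mapping.single v d"
    using M(4) by (rule exponents_insertE)
  have M'_exp: "\<Sum>\<^sub># M' \<in> exponents V"
    using M'(1) A_exponents by (intro sum_mset_in_exponents) blast
  have "p + Poly_Mapping.single v b =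
      (\<Sum>\<^sub># M' + scale (n - j) f + s') + Poly_Mapping.single v (j + d)"
    using M(3) M'(4) s'(2) by (simp add: single_add ac_simps)
  then have peq: "p = \<Sum>\<^sub># M' + scale (n - j) f + s'" and beq: "b = j + d"
    using add_single_v_eq_iff[of p "\<Sum>\<^sub># M' + scale (n - j) f + s'" b "j + d"]
      p M'_exp f_exponents s'(1) by auto
  have j: "j \<le> ?c" using beq M'(3) by simp
  have M'_in: "\<Sum>\<^sub># M' + s' \<in> sums_above V A j"
    using M' M'_exp s'(1) by (intro sums_aboveI) auto
  have "scale (?c - j) f + (\<Sum>\<^sub># M' + s') \<in> sums_above V A ((?c - j) + j)"
    by (intro sums_above_add sums_above_scale f_in_power M'_in)
  moreover have "scale (n - j) f = scale (n - ?c) f + scale (?c - j) f"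
    using j by (simp flip: scale_add_left)
  ultimately show "\<exists>q\<in>sums_above V A ?c. p = scale (n - ?c) f + q"
    using j peq
    by (intro bexI[of _ "scale (?c - j) f + (\<Sum>\<^sub># M' + s')"]) (simp_all add: ac_simps)
next
  let ?c = "min b n" and ?W = "insert v V"
  assume "\<exists>q\<in>sums_above V A ?c. p = scale (n - ?c) f + q"
  then obtain q where q: "q \<in> sums_above V A ?c" "p = scale (n - ?c) f + q" by blast
  obtain M s where M: "set_mset M \<subseteq> A" "size M = ?c" "q = \<Sum>\<^sub># M + s" "s \<in> exponents V"
    using q(1) by (rule sums_aboveE)
  have "f \<in> sums_above ?W B 1"
    using sums_aboveI[of "{#f#}" B 1 0 ?W] f_in_B exponents_insert[OF f_exponents] by simp
  then have "scale (n - ?c) f + (\<Sum>\<^sub># M + Poly_Mapping.single v ?c)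
      \<in> sums_above ?W B ((n - ?c) + ?c)"
    using sum_mset_A_shifted[OF M(1)] M(2) by (intro sums_above_add sums_above_scale) simp_all
  then have "scale (n - ?c) f + (\<Sum>\<^sub># M + Poly_Mapping.single v ?c) +
      (s + Poly_Mapping.single v (b - ?c)) \<in> sums_above ?W B n"
    using exponents_insert[OF M(4)]
    by (intro sums_above_upward_closed[where m = "scale (n - ?c) f + (\<Sum>\<^sub># M + Poly_Mapping.single v ?c)"])
      simp_all
  moreover have "Poly_Mapping.single v b =
      Poly_Mapping.single v ?c + Poly_Mapping.single v (b - ?c)"
    by (simp flip: single_add)
  ultimately show "p + Poly_Mapping.single v b \<in> sums_above ?W B n"
    using q(2) M(3) by (simp add: ac_simps)
qed

lemma scale_translated_cancel:
  assumes "scale k p = scale (k * c) f + q" "1 \<le> k"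
  obtains p' where "p = scale c f + p'" "scale k p' = q"
proof
  have le: "c * Poly_Mapping.lookup f t \<le> Poly_Mapping.lookup p t" for t
  proof -
    have "k * Poly_Mapping.lookup p t = k * (c * Poly_Mapping.lookup f t) + Poly_Mapping.lookup q t"
      using arg_cong[OF assms(1), of "\<lambda>m. Poly_Mapping.lookup m t"]
      by (simp add: lookup_add)
    then have "k * (c * Poly_Mapping.lookup f t) \<le> k * Poly_Mapping.lookup p t" by simp
    then show ?thesis using assms(2) by simp
  qed
  show "p = scale c f + (p - scale c f)"
    by (rule poly_mapping_eqI) (simp add: lookup_add lookup_minus le)
  then have "scale (k * c) f + scale k (p - scale c f) = scale (k * c) f + q"
    using assms(1) by (metis scale_add_right scale_scale)
  then show "scale k (p - scale c f) = q" by simp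
qed

text \<open>
  Taking \<open>k\<close>-th powers multiplies both \<open>b\<close> and \<open>n\<close>, hence also $\min(b,n)$, by \<open>k\<close>, so the
  description of the components is compatible with the saturation condition in each degree of \<open>v\<close>.
  The condition for \<open>J\<close> itself is the one in degree \<open>n\<close>, where no factor \<open>f\<close> is left.
\<close>

lemma saturated_powers_iff: "saturated_powers V A \<longleftrightarrow> saturated_powers (insert v V) B"
proof
  assume sat: "saturated_powers V A"
  show "saturated_powers (insert v V) B"
    unfolding saturated_powers_def
  proof (intro allI impI)
    fix n m and k :: nat
    assume n: "1 \<le> n" and m: "m \<in> exponents (insert v V)" and k: "1 \<le> k"
      and mk: "scale k m \<in> sums_above (insert v V) B (n * k)"
    obtain p b where p: "p \<in> exponents V" "m = p + Poly_Mapping.single v b"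
      using m by (rule exponents_insertE)
    define c where "c = min b n"
    have min_k: "min (k * b) (n * k) = c * k" and diff_k: "n * k - c * k = k * (n - c)"
      unfolding c_def by (simp_all add: nat_mult_min_left diff_mult_distrib2 mult.commute[of k])
    have "scale k p + Poly_Mapping.single v (k * b) \<in> sums_above (insert v V) B (n * k)"
      using mk p(2) by (simp add: scale_add_right scale_single)
    then obtain q where q: "q \<in> sums_above V A (c * k)" "scale k p = scale (k * (n - c)) f + q"
      using power_component[of "scale k p" "k * b" "n * k"] p(1) min_k diff_k by auto
    obtain p' where p': "p = scale (n - c) f + p'" "scale k p' = q"
      using q(2) k by (rule scale_translated_cancel)
    have p'_exp: "p' \<in> exponents V" using p(1) p'(1) by simp
    have "p' \<in> sums_above V A c"
    proof (cases "c = 0")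
      case False
      then show ?thesis
        using sat p'_exp k q(1) p'(2) unfolding saturated_powers_def
        by (metis One_nat_def Suc_leI not_gr_zero)
    qed (simp add: p'_exp)
    then show "m \<in> sums_above (insert v V) B n"
      using power_component[OF p(1), of b n] p(2) p'(1) unfolding c_def by blast
  qed
next
  assume sat: "saturated_powers (insert v V) B"
  show "saturated_powers V A"
    unfolding saturated_powers_def
  proof (intro allI impI)
    fix n p and k :: nat
    assume n: "1 \<le> n" and p: "p \<in> exponents V" and k: "1 \<le> k"
      and pk: "scale k p \<in> sums_above V A (n * k)"
    have "scale k p + Poly_Mapping.single v (n * k) \<in> sums_above (insert v V) B (n * k)"
      using power_component[of "scale k p" "n * k" "n * k"] p pk by simp
    then have "scale k (p + Poly_Mapping.single v n) \<in> sums_above (insert v V) B (n * k)"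
      by (simp add: scale_add_right scale_single mult.commute)
    then have "p + Poly_Mapping.single v n \<in> sums_above (insert v V) B n"
      using sat n k exponents_insert[OF p] unfolding saturated_powers_def
      by (meson exponents_add_iff insertI1 single_in_exponents)
    then show "p \<in> sums_above V A n"
      using power_component[OF p, of n n] by simp
  qed
qed

end


section \<open>Ideals spanned by monomials\<close>

text \<open>
  For a set \<open>E\<close> of exponent vectors closed under adding vectors supported on \<open>V\<close>, this is the ideal
  of $K[V]$ spanned by the monomials with exponents in \<open>E\<close>.
\<close>

definition polys_on :: "('v \<Rightarrow>\<^sub>0 nat) set \<Rightarrow> ('v, 'k::field) mvpoly set" where
  "polys_on E = {p. Poly_Mapping.keys p \<subseteq> E}"

lemma zero_in_polys_on [simp]: "0 \<in> polys_on E"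
  by (simp add: polys_on_def)

lemma single_in_polys_on: "m \<in> E \<Longrightarrow> Poly_Mapping.single m c \<in> polys_on E"
  by (simp add: polys_on_def)

lemma single_in_polys_on_iff: "c \<noteq> 0 \<Longrightarrow> Poly_Mapping.single m c \<in> polys_on E \<longleftrightarrow> m \<in> E"
  by (simp add: polys_on_def)

lemma polys_on_add: "p \<in> polys_on E \<Longrightarrow> q \<in> polys_on E \<Longrightarrow> p + q \<in> polys_on E"
  unfolding polys_on_def using Poly_Mapping.keys_add[of p q] by blast

lemma polys_on_uminus: "p \<in> polys_on E \<Longrightarrow> - p \<in> polys_on E"
  by (simp add: polys_on_def)

lemma polys_on_mult:
  assumes "p \<in> polys_on E" "q \<in> polys_on F"
    and "\<And>a b. a \<in> E \<Longrightarrow> b \<in> F \<Longrightarrow> a + b \<in> H"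
  shows "p * q \<in> polys_on H"
  using assms Poly_Mapping.keys_mult[of p q] unfolding polys_on_def by blast

lemma polys_on_induct [consumes 1, case_names zero monomial add]:
  fixes p :: "('v, 'k::field) mvpoly"
  assumes "p \<in> polys_on E"
    and zero: "P 0"
    and monomial: "\<And>m c. m \<in> E \<Longrightarrow> P (Poly_Mapping.single m c)"
    and add: "\<And>p q. P p \<Longrightarrow> P q \<Longrightarrow> P (p + q)"
  shows "P p"
proof -
  have "finite X \<Longrightarrow> X \<subseteq> E \<Longrightarrow>
      P (\<Sum>m\<in>X. Poly_Mapping.single m (Poly_Mapping.lookup p m))" for X
    by (induction X rule: finite_induct) (auto intro: zero monomial add)
  moreover have "(\<Sum>m\<in>Poly_Mapping.keys p. Poly_Mapping.single m (Poly_Mapping.lookup p m)) = p"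
    by (rule poly_mapping_eqI)
      (simp add: lookup_sum lookup_single when_def sum.delta in_keys_iff)
  ultimately show ?thesis
    using assms(1) unfolding polys_on_def by (metis finite_keys mem_Collect_eq)
qed

lemma carrier_poly_ring: "carrier (poly_ring V) = polys_on (exponents V)"
  by (auto simp: poly_ring_def polys_on_def exponents_def)

lemma poly_ring_simps [simp]:
  "p \<otimes>\<^bsub>poly_ring V\<^esub> q = p * q" "\<one>\<^bsub>poly_ring V\<^esub> = 1"
  "p \<oplus>\<^bsub>poly_ring V\<^esub> q = p + q" "\<zero>\<^bsub>poly_ring V\<^esub> = 0"
  by (simp_all add: poly_ring_def)

lemma poly_ring_nat_pow [simp]: "p [^]\<^bsub>poly_ring V\<^esub> (n::nat) = p ^ n"
  by (induction n) (simp_all add: nat_pow_def mult.commute)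

lemma poly_ring_finsum:
  fixes g :: "'i \<Rightarrow> ('v, 'k::field) mvpoly"
  assumes "finite X" "\<And>i. i \<in> X \<Longrightarrow> g i \<in> carrier (poly_ring V)"
  shows "(\<Oplus>\<^bsub>poly_ring V\<^esub>i\<in>X. g i) = (\<Sum>i\<in>X. g i)"
proof -
  interpret R: cring "poly_ring V :: ('v, 'k) mvpoly ring" by (rule cring_poly_ring)
  show ?thesis
    using assms
  proof (induction X)
    case (insert i X)
    then have "(\<Oplus>\<^bsub>poly_ring V\<^esub>i\<in>insert i X. g i) = g i \<oplus>\<^bsub>poly_ring V\<^esub> (\<Oplus>\<^bsub>poly_ring V\<^esub>i\<in>X. g i)"
      by (intro R.finsum_insert) auto
    then show ?case using insert by simp
  qed simp
qed

lemma ideal_polys_on: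
  assumes "E \<subseteq> exponents V" and up: "\<And>m s. m \<in> E \<Longrightarrow> s \<in> exponents V \<Longrightarrow> m + s \<in> E"
  shows "ideal (polys_on E) (poly_ring V :: ('v, 'k::field) mvpoly ring)"
proof (rule idealI)
  let ?R = "poly_ring V :: ('v, 'k) mvpoly ring"
  interpret R: cring ?R by (rule cring_poly_ring)
  show "ring ?R" by (rule R.ring_axioms)
  have sub: "polys_on E \<subseteq> carrier ?R"
    using assms(1) unfolding carrier_poly_ring polys_on_def by blast
  show "subgroup (polys_on E) (add_monoid ?R)"
  proof
    fix p :: "('v, 'k) mvpoly" assume p: "p \<in> polys_on E"
    have "\<ominus>\<^bsub>?R\<^esub> p = - p"
      using p polys_on_uminus[OF p] sub by (intro R.minus_equality) auto
    then show "inv\<^bsub>add_monoid ?R\<^esub> p \<in> polys_on E"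
      using polys_on_uminus[OF p] by (simp add: a_inv_def)
  qed (use sub in \<open>auto intro: polys_on_add\<close>)
  fix p x :: "('v, 'k) mvpoly" assume p: "p \<in> polys_on E" and x: "x \<in> carrier ?R"
  then have "p * x \<in> polys_on E"
    unfolding carrier_poly_ring by (rule polys_on_mult) (rule up)
  then show "x \<otimes>\<^bsub>?R\<^esub> p \<in> polys_on E" "p \<otimes>\<^bsub>?R\<^esub> x \<in> polys_on E"
    by (simp_all add: mult.commute)
qed

abbreviation monomial_power :: "'v set \<Rightarrow> ('v \<Rightarrow>\<^sub>0 nat) set \<Rightarrow> nat \<Rightarrow> ('v, 'k::field) mvpoly set" where
  "monomial_power V A n \<equiv> polys_on (sums_above V A n)"

lemma ideal_monomial_power: "ideal (monomial_power V A n) (poly_ring V)"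
  by (rule ideal_polys_on) (auto intro: sums_above_upward_closed sums_above_in_exponents)

lemma monomial_power_mult:
  "p \<in> monomial_power V A n \<Longrightarrow> q \<in> monomial_power V A k \<Longrightarrow> p * q \<in> monomial_power V A (n + k)"
  by (rule polys_on_mult) (auto intro: sums_above_add)

lemma monomial_power_antimono: "k \<le> n \<Longrightarrow> monomial_power V A n \<subseteq> monomial_power V A k"
  unfolding polys_on_def using sums_above_antimono by blast

lemma ideal_prod_monomial_power:
  "monomial_power V A n \<cdot>\<^bsub>poly_ring V\<^esub> monomial_power V A k =
    (monomial_power V A (n + k) :: ('v, 'k::field) mvpoly set)" (is "?I = ?J")
proof
  show "?I \<subseteq> ?J"
  proof
    fix p assume "p \<in> ?I"
    then show "p \<in> ?J"
      by induction (auto intro: monomial_power_mult polys_on_add)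
  qed
  show "?J \<subseteq> ?I"
  proof
    fix p :: "('v, 'k) mvpoly"
    assume "p \<in> ?J"
    then show "p \<in> ?I"
    proof (induction p rule: polys_on_induct)
      case zero
      show ?case
        using ideal_prod.prod[of 0 "monomial_power V A n" 0 "monomial_power V A k" "poly_ring V"]
        by simp
    next
      case (monomial m c)
      then obtain m1 m2 where m: "m1 \<in> sums_above V A n" "m2 \<in> sums_above V A k" "m = m1 + m2"
        by (rule sums_above_split)
      show ?case
        using ideal_prod.prod[of "Poly_Mapping.single m1 c" "monomial_power V A n"
            "Poly_Mapping.single m2 1" "monomial_power V A k" "poly_ring V"] m
        by (simp add: single_in_polys_on mult_single)
    next
      case (add p q)
      then show ?case using ideal_prod.sum[of p "poly_ring V" _ _ q] by simp
    qed
  qed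
qed

lemma ideals_set_pow_monomial_power:
  "monomial_power V A n [^]\<^bsub>ideals_set (poly_ring V)\<^esub> (k::nat) =
    (monomial_power V A (n * k) :: ('v, 'k::field) mvpoly set)"
proof (induction k)
  case 0
  then show ?case
    by (simp add: nat_pow_def ideals_set_def carrier_poly_ring)
next
  case (Suc k)
  interpret R: cring "poly_ring V :: ('v, 'k) mvpoly ring" by (rule cring_poly_ring)
  interpret M: comm_monoid "ideals_set (poly_ring V :: ('v, 'k) mvpoly ring)"
    by (rule R.ideals_set_is_comm_monoid)
  show ?case
    using Suc ideal_prod_monomial_power[of V A "n * k" n]
    by (simp add: M.nat_pow_Suc add.commute) (simp add: ideals_set_def add.commute)
qed

section \<open>Elements integral over a filtration\<close>

text \<open>
  A descending multiplicative filtration such as the powers $P_i=I^i$ of an ideal: what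
  remains of the ideal in the arguments with integral equations.
\<close>

locale ring_filtration =
  fixes P :: "nat \<Rightarrow> 'a::comm_ring_1 set"
  assumes one: "1 \<in> P 0"
    and zero: "0 \<in> P i"
    and add: "x \<in> P i \<Longrightarrow> y \<in> P i \<Longrightarrow> x + y \<in> P i"
    and uminus: "x \<in> P i \<Longrightarrow> - x \<in> P i"
    and mult: "x \<in> P i \<Longrightarrow> y \<in> P j \<Longrightarrow> x * y \<in> P (i + j)"
    and antimono: "i \<le> j \<Longrightarrow> P j \<subseteq> P i"
begin

lemma sum: "(\<And>i. i \<in> X \<Longrightarrow> g i \<in> P j) \<Longrightarrow> (\<Sum>i\<in>X. g i) \<in> P j"
  by (induction X rule: infinite_finite_induct) (auto intro: zero add)

text \<open>
  Multiplying the equation by $x^{N-d}$ expresses $x^N$ by the products $a_ix^{N-i}$. By induction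
  $x^{N-i}$ lies in $P_{N-i-d}$, and the factor $a_i$ makes up for the missing \<open>i\<close>. For $N\leq d$ the
  truncated difference is \<open>0\<close> and nothing is claimed beyond $x^N\in P_0$.
\<close>

lemma power_of_integral:
  assumes x: "x \<in> P 0" and a: "\<And>i. i \<in> {1..d} \<Longrightarrow> a i \<in> P i"
    and eq: "x ^ d + (\<Sum>i\<in>{1..d}. a i * x ^ (d - i)) = 0"
  shows "x ^ N \<in> P (N - d)"
proof (induction N rule: less_induct)
  case (less N)
  show ?case
  proof (cases "N \<le> d")
    case True
    have "x ^ N \<in> P 0"
    proof (induction N)
      case (Suc N)
      then show ?case using mult[OF x Suc] by simp
    qed (simp add: one)
    then show ?thesis using True by simp
  next
    case False
    have step: "a i * x ^ (N - i) \<in> P (N - d)" if i: "i \<in> {1..d}" for i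
    proof -
      have "a i * x ^ (N - i) \<in> P (i + (N - i - d))"
        using False i by (intro mult a less.IH) auto
      moreover have "N - d \<le> i + (N - i - d)" by simp
      ultimately show ?thesis using antimono by blast
    qed
    have "x ^ d = - (\<Sum>i\<in>{1..d}. a i * x ^ (d - i))"
      using eq by (simp add: eq_neg_iff_add_eq_0)
    moreover have "x ^ N = x ^ (N - d) * x ^ d"
      using False by (simp flip: power_add)
    ultimately have "x ^ N = - (\<Sum>i\<in>{1..d}. x ^ (N - d) * (a i * x ^ (d - i)))"
      by (simp add: sum_distrib_left)
    also have "\<dots> = - (\<Sum>i\<in>{1..d}. a i * x ^ (N - i))"
    proof -
      have "x ^ (N - d) * (a i * x ^ (d - i)) = a i * x ^ (N - i)" if "i \<in> {1..d}" for i
      proof -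
        have "N - i = (N - d) + (d - i)" using that False by simp
        then show ?thesis by (simp add: power_add mult_ac)
      qed
      then show ?thesis by (intro arg_cong[where f = uminus] sum.cong refl)
    qed
    finally show ?thesis using step by (auto intro!: uminus sum)
  qed
qed

text \<open>
  Every product $x^j(x-z)^N$ lies in $P_{j+N-d}$; this form is stable under
  $x^j(x-z)^{N+1} = x^{j+1}(x-z)^N - z\,x^j(x-z)^N$ and avoids the binomial expansion.
\<close>

lemma power_of_difference:
  assumes x: "\<And>N. x ^ N \<in> P (N - d)" and z: "z \<in> P 1"
  shows "(x - z) ^ N \<in> P (N - d)"
proof -
  have "x ^ j * (x - z) ^ N \<in> P (j + N - d)" for j
  proof (induction N arbitrary: j)
    case 0
    then show ?case using x[of j] by simp
  next
    case (Suc N)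
    have "z * (x ^ j * (x - z) ^ N) \<in> P (1 + (j + N - d))"
      using z Suc by (rule mult)
    moreover have "j + Suc N - d \<le> 1 + (j + N - d)" by simp
    ultimately have "z * (x ^ j * (x - z) ^ N) \<in> P (j + Suc N - d)"
      using antimono by blast
    moreover have "x ^ Suc j * (x - z) ^ N \<in> P (j + Suc N - d)"
      using Suc[of "Suc j"] by simp
    ultimately have "x ^ Suc j * (x - z) ^ N + - (z * (x ^ j * (x - z) ^ N)) \<in> P (j + Suc N - d)"
      by (intro add uminus)
    then show ?case by (simp add: algebra_simps)
  qed
  from this[of 0] show ?thesis by simp
qed

end

section \<open>Monomials of largest norm\<close>

lemma lookup_single_mult:
  fixes q :: "('v, 'k::field) mvpoly"
  shows "Poly_Mapping.lookup (Poly_Mapping.single m c * q) (m + k) = c * Poly_Mapping.lookup q k"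
proof -
  have "q \<in> polys_on UNIV" by (simp add: polys_on_def)
  then show ?thesis
    by (induction q rule: polys_on_induct)
      (simp_all add: mult_single lookup_single when_def lookup_add algebra_simps)
qed

text \<open>
  If an additive functional attains its maximum on the support of \<open>y\<close> only at \<open>m\<close>, the only way to
  write $m^N$ as a product of \<open>N\<close> monomials of \<open>y\<close> is to take \<open>m\<close> each time.
\<close>

lemma coefficient_of_extremal_power:
  fixes y :: "('v, 'k::field) mvpoly" and \<phi> :: "('v \<Rightarrow>\<^sub>0 nat) \<Rightarrow> nat"
  assumes \<phi>_0: "\<phi> 0 = 0" and \<phi>_add: "\<And>p q. \<phi> (p + q) = \<phi> p + \<phi> q"
    and extremal: "\<And>p. p \<in> Poly_Mapping.keys y \<Longrightarrow> p \<noteq> m \<Longrightarrow> \<phi> p < \<phi> m"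
  shows "Poly_Mapping.lookup (y ^ N) (scale N m) = Poly_Mapping.lookup y m ^ N"
proof -
  define r where "r = y - Poly_Mapping.single m (Poly_Mapping.lookup y m)"
  have y: "y = Poly_Mapping.single m (Poly_Mapping.lookup y m) + r" by (simp add: r_def)
  have r: "p \<in> Poly_Mapping.keys y \<and> p \<noteq> m" if "p \<in> Poly_Mapping.keys r" for p
    using that unfolding r_def
    by (auto simp: in_keys_iff lookup_minus lookup_single when_def split: if_splits)
  have \<phi>_scale: "\<phi> (scale k m) = k * \<phi> m" for k
    by (induction k) (simp_all add: \<phi>_0 \<phi>_add scale_Suc)
  have "(\<forall>p\<in>Poly_Mapping.keys (y ^ N). \<phi> p \<le> N * \<phi> m) \<and>
      Poly_Mapping.lookup (y ^ N) (scale N m) = Poly_Mapping.lookup y m ^ N"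
  proof (induction N)
    case 0
    then show ?case by (simp add: \<phi>_0)
  next
    case (Suc N)
    have "\<phi> p \<le> Suc N * \<phi> m" if p: "p \<in> Poly_Mapping.keys (y ^ Suc N)" for p
    proof -
      obtain a b where ab: "p = a + b" "a \<in> Poly_Mapping.keys y" "b \<in> Poly_Mapping.keys (y ^ N)"
        using p Poly_Mapping.keys_mult[of y "y ^ N"] unfolding power_Suc by blast
      have "\<phi> a \<le> \<phi> m" using extremal[OF ab(2)] by (cases "a = m") auto
      moreover have "\<phi> b \<le> N * \<phi> m" using ab(3) Suc by blast
      ultimately show ?thesis by (simp add: ab(1) \<phi>_add)
    qed
    moreover have "scale (Suc N) m \<notin> Poly_Mapping.keys (r * y ^ N)"
    proof
      assume "scale (Suc N) m \<in> Poly_Mapping.keys (r * y ^ N)"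
      then obtain a b where ab: "scale (Suc N) m = a + b"
          "a \<in> Poly_Mapping.keys r" "b \<in> Poly_Mapping.keys (y ^ N)"
        using Poly_Mapping.keys_mult[of r "y ^ N"] by blast
      have "\<phi> a < \<phi> m" using extremal r[OF ab(2)] by blast
      moreover have "\<phi> b \<le> N * \<phi> m" using ab(3) Suc by blast
      moreover have "\<phi> a + \<phi> b = Suc N * \<phi> m"
        using \<phi>_scale[of "Suc N"] by (simp only: ab(1) \<phi>_add)
      ultimately show False by simp
    qed
    then have "Poly_Mapping.lookup (r * y ^ N) (m + scale N m) = 0"
      by (simp add: in_keys_iff scale_Suc)
    moreover have "y ^ Suc N = Poly_Mapping.single m (Poly_Mapping.lookup y m) * y ^ N + r * y ^ N"
      by (subst (1) power_Suc, subst (1) y) (simp add: distrib_right)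
    ultimately show ?case
      using Suc by (simp add: scale_Suc lookup_add lookup_single_mult del: power_Suc) simp
  qed
  then show ?thesis by blast
qed

lemma two_mult_le_sum_of_squares:
  fixes a b :: nat
  shows "2 * (a * b) \<le> a * a + b * b" and "a \<noteq> b \<Longrightarrow> 2 * (a * b) < a * a + b * b"
proof -
  have *: "2 * (a * b) + k * k = a * a + b * b" if "a = b + k \<or> b = a + k" for k
    using that by (auto simp: algebra_simps)
  obtain k where k: "a = b + k \<or> b = a + k"
    using nat_le_linear[of a b] by (metis le_Suc_ex)
  show "2 * (a * b) \<le> a * a + b * b" using *[OF k] by simp
  show "2 * (a * b) < a * a + b * b" if "a \<noteq> b"
  proof -
    have "0 < k * k" using k that by auto
    then show ?thesis using *[OF k] by linarith
  qed
qed

text \<open>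
  If \<open>m\<close> has the largest Euclidean norm in the support of \<open>y\<close>, the functional
  $p\mapsto\langle m,p\rangle$ has \<open>m\<close> as its only maximum there, because
  $2\langle m,p\rangle < |m|^2+|p|^2\leq 2|m|^2$ for $p\neq m$.
\<close>

lemma ex_monomial_with_powers:
  fixes y :: "('v, 'k::field) mvpoly"
  assumes "finite V" "y \<in> polys_on (exponents V)" "y \<noteq> 0"
  shows "\<exists>m\<in>Poly_Mapping.keys y. \<forall>N. scale N m \<in> Poly_Mapping.keys (y ^ N)"
proof -
  define Q where "Q p = (\<Sum>t\<in>V. Poly_Mapping.lookup p t * Poly_Mapping.lookup p t)"
    for p :: "'v \<Rightarrow>\<^sub>0 nat"
  have "Poly_Mapping.keys y \<noteq> {}" using assms(3) by simp
  then obtain m where m: "m \<in> Poly_Mapping.keys y"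
      and max: "\<And>p. p \<in> Poly_Mapping.keys y \<Longrightarrow> Q p \<le> Q m"
    using finite_keys[of y] Max_in[of "Q ` Poly_Mapping.keys y"]
      Max_ge[of "Q ` Poly_Mapping.keys y"] by fastforce
  define \<phi> where "\<phi> p = (\<Sum>t\<in>V. Poly_Mapping.lookup m t * Poly_Mapping.lookup p t)"
    for p :: "'v \<Rightarrow>\<^sub>0 nat"
  have "\<phi> p < \<phi> m" if p: "p \<in> Poly_Mapping.keys y" "p \<noteq> m" for p
  proof -
    have "m \<in> exponents V" "p \<in> exponents V"
      using assms(2) m p(1) unfolding polys_on_def by auto
    moreover obtain t where t: "Poly_Mapping.lookup m t \<noteq> Poly_Mapping.lookup p t"
      using p(2) poly_mapping_eqI by metis
    ultimately have "t \<in> V" unfolding exponents_iff by metis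
    have "2 * \<phi> p < (\<Sum>t\<in>V. Poly_Mapping.lookup m t * Poly_Mapping.lookup m t +
        Poly_Mapping.lookup p t * Poly_Mapping.lookup p t)"
      unfolding \<phi>_def sum_distrib_left
      using assms(1) \<open>t \<in> V\<close> t two_mult_le_sum_of_squares
      by (intro sum_strict_mono_ex1) blast+
    also have "\<dots> = Q m + Q p" by (simp add: Q_def sum.distrib)
    also have "\<dots> \<le> 2 * Q m" using max[OF p(1)] by simp
    also have "Q m = \<phi> m" by (simp add: Q_def \<phi>_def)
    finally show ?thesis by simp
  qed
  then have "Poly_Mapping.lookup (y ^ N) (scale N m) = Poly_Mapping.lookup y m ^ N" for N
    by (intro coefficient_of_extremal_power[of \<phi>])
      (simp_all add: \<phi>_def lookup_add distrib_left sum.distrib)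
  then show ?thesis using m by (auto simp: in_keys_iff intro!: bexI[of _ m])
qed

section \<open>Integral closure and normality of monomial ideals\<close>

lemma integral_closure_poly_ring:
  fixes I :: "('v, 'k::field) mvpoly set"
  assumes "ideal I (poly_ring V)"
  shows "integral_closure (poly_ring V) I =
    {x \<in> carrier (poly_ring V). \<exists>d a. 1 \<le> d \<and>
       (\<forall>i\<in>{1..d}. a i \<in> I [^]\<^bsub>ideals_set (poly_ring V)\<^esub> i) \<and>
       x ^ d + (\<Sum>i\<in>{1..d}. a i * x ^ (d - i)) = 0}"
proof -
  let ?R = "poly_ring V :: ('v, 'k) mvpoly ring"
  interpret R: cring ?R by (rule cring_poly_ring)
  interpret M: comm_monoid "ideals_set ?R" by (rule R.ideals_set_is_comm_monoid)
  have "I [^]\<^bsub>ideals_set ?R\<^esub> i \<subseteq> carrier ?R" for i :: nat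
  proof -
    have "I [^]\<^bsub>ideals_set ?R\<^esub> i \<in> carrier (ideals_set ?R)"
      using assms by (intro M.nat_pow_closed) (simp add: ideals_set_def)
    then show ?thesis
      by (simp add: ideals_set_def ideal.Icarr subsetI)
  qed
  moreover have "x ^ n \<in> carrier ?R" if "x \<in> carrier ?R" for x n
    using R.nat_pow_closed[OF that, of n] by simp
  moreover have "p * q \<in> carrier ?R" if "p \<in> carrier ?R" "q \<in> carrier ?R" for p q
    using R.m_closed[OF that] by simp
  ultimately have "(\<Oplus>\<^bsub>?R\<^esub>i\<in>{1..d}. a i * x ^ (d - i)) = (\<Sum>i\<in>{1..d}. a i * x ^ (d - i))"
    if "x \<in> carrier ?R" "\<forall>i\<in>{1..d}. a i \<in> I [^]\<^bsub>ideals_set ?R\<^esub> i" for x d a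
    using that by (intro poly_ring_finsum) blast+
  then show ?thesis
    unfolding integral_closure_def by (auto cong: conj_cong)
qed

lemma ring_filtration_monomial_power:
  "ring_filtration (\<lambda>i. monomial_power V A (n * i) :: ('v, 'k::field) mvpoly set)"
proof
  show "1 \<in> monomial_power V A (n * 0)"
    by (simp add: polys_on_def)
  show "x * y \<in> monomial_power V A (n * (i + j))"
    if "x \<in> monomial_power V A (n * i)" "y \<in> monomial_power V A (n * j)"
    for x y :: "('v, 'k) mvpoly" and i j
    using monomial_power_mult[OF that] by (simp add: distrib_left)
  show "monomial_power V A (n * j) \<subseteq> (monomial_power V A (n * i) :: ('v, 'k) mvpoly set)"
    if "i \<le> j" for i j
    using that by (intro monomial_power_antimono) simp
qed (auto intro: polys_on_add polys_on_uminus)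

text \<open>
  Splitting off from \<open>x\<close> its terms \<open>z\<close> in the ideal keeps the powers of the rest \<open>y\<close> in the filtration up
  to the shift \<open>d\<close>. A monomial \<open>m\<close> of \<open>y\<close> all of whose powers survive then has a multiple in
  the corresponding power of the ideal, and saturation contradicts the choice of \<open>y\<close>.
\<close>

lemma integral_over_saturated_power:
  fixes x :: "('v, 'k::field) mvpoly"
  assumes fin: "finite V" "finite A" and A: "A \<subseteq> exponents V"
    and sat: "\<And>m k. m \<in> exponents V \<Longrightarrow> 1 \<le> k \<Longrightarrow> scale k m \<in> sums_above V A (n * k) \<Longrightarrow>
      m \<in> sums_above V A n"
    and x: "x \<in> polys_on (exponents V)"
    and a: "\<And>i. i \<in> {1..d} \<Longrightarrow> a i \<in> monomial_power V A (n * i)"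
    and eq: "x ^ d + (\<Sum>i\<in>{1..d}. a i * x ^ (d - i)) = 0"
  shows "x \<in> monomial_power V A n"
proof -
  interpret F: ring_filtration "\<lambda>i. monomial_power V A (n * i) :: ('v, 'k) mvpoly set"
    by (rule ring_filtration_monomial_power)
  define z where
    "z = (\<Sum>m\<in>Poly_Mapping.keys x \<inter> sums_above V A n.
      Poly_Mapping.single m (Poly_Mapping.lookup x m))"
  define y where "y = x - z"
  have lookup_z: "Poly_Mapping.lookup z m =
      (if m \<in> sums_above V A n then Poly_Mapping.lookup x m else 0)" for m
    by (auto simp: z_def lookup_sum lookup_single when_def sum.delta in_keys_iff)
  have z: "z \<in> monomial_power V A n"
    by (auto simp: polys_on_def in_keys_iff lookup_z split: if_splits)
  have y_keys: "Poly_Mapping.keys y \<subseteq> Poly_Mapping.keys x - sums_above V A n"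
    by (auto simp: y_def in_keys_iff lookup_minus lookup_z split: if_splits)
  have y_powers: "y ^ N \<in> monomial_power V A (n * (N - d))" for N
    unfolding y_def
  proof (rule F.power_of_difference)
    show "x ^ N \<in> monomial_power V A (n * (N - d))" for N
      using x a eq by (intro F.power_of_integral) auto
    show "z \<in> monomial_power V A (n * 1)" using z by simp
  qed
  have "y = 0"
  proof (rule ccontr)
    assume "y \<noteq> 0"
    moreover have "y \<in> polys_on (exponents V)"
      using x y_keys unfolding polys_on_def by blast
    ultimately obtain m where m: "m \<in> Poly_Mapping.keys y"
        "\<And>N. scale N m \<in> Poly_Mapping.keys (y ^ N)"
      using ex_monomial_with_powers[OF fin(1), of y] by blast
    have "scale N m \<in> sums_above V A (n * (N - d))" for N
      using m(2) y_powers[of N] unfolding polys_on_def by blast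
    then obtain k where "1 \<le> k" "scale k m \<in> sums_above V A (n * k)"
      using multiple_in_power_if_almost_in_powers[OF fin A, of d m n] by blast
    moreover have "m \<in> exponents V"
      using m(1) y_keys x unfolding polys_on_def by blast
    ultimately have "m \<in> sums_above V A n" using sat by blast
    then show False using m(1) y_keys by blast
  qed
  then show ?thesis using z by (simp add: y_def)
qed

lemma subset_integral_closure_monomial_power:
  "monomial_power V A n \<subseteq>
    integral_closure (poly_ring V) (monomial_power V A n :: ('v, 'k::field) mvpoly set)"
proof
  fix x :: "('v, 'k) mvpoly" assume x: "x \<in> monomial_power V A n"
  have "x \<in> carrier (poly_ring V)"
    using x monomial_power_antimono[of 0 n V A] by (auto simp: carrier_poly_ring)
  then show "x \<in> integral_closure (poly_ring V) (monomial_power V A n)"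
    unfolding integral_closure_poly_ring[OF ideal_monomial_power] ideals_set_pow_monomial_power
    using x by (auto intro!: exI[of _ 1] exI[of _ "\<lambda>_. - x"] polys_on_uminus)
qed

text \<open>
  The monomial \<open>x\<close> satisfies the integral equation $x^k + a_k = 0$ with $a_k=-x^k$.
\<close>

lemma monomial_in_integral_closure:
  fixes n :: nat
  assumes m: "m \<in> exponents V" and k: "1 \<le> k" and mk: "scale k m \<in> sums_above V A (n * k)"
  shows "Poly_Mapping.single m (1::'k::field) \<in>
    integral_closure (poly_ring V) (monomial_power V A n)"
proof -
  let ?x = "Poly_Mapping.single m (1::'k)"
  define a where "a i = (if i = k then - (?x ^ k) else 0)" for i
  have pow: "?x ^ N = Poly_Mapping.single (scale N m) 1" for N
    by (induction N) (simp_all add: mult_single scale_Suc)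
  have "a i \<in> monomial_power V A (n * i)" for i
    using mk by (auto simp: a_def pow intro!: polys_on_uminus single_in_polys_on)
  moreover have "(\<Sum>i\<in>{1..k}. a i * ?x ^ (k - i)) = (\<Sum>i\<in>{1..k}. if i = k then - (?x ^ k) else 0)"
    by (intro sum.cong) (auto simp: a_def)
  then have "?x ^ k + (\<Sum>i\<in>{1..k}. a i * ?x ^ (k - i)) = 0"
    using k by simp
  ultimately show ?thesis
    unfolding integral_closure_poly_ring[OF ideal_monomial_power] ideals_set_pow_monomial_power
    using m k by (auto simp: carrier_poly_ring single_in_polys_on)
qed

text \<open>
  For a single power this compares an ideal with its integral closure: the monomials in the closure
  give one direction, and the absence of any further polynomial gives the other.
\<close>

theorem normal_monomial_ideal_iff:
  assumes fin: "finite V" "finite A" and A: "A \<subseteq> exponents V"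
  shows "normal_ideal (poly_ring V) (monomial_power V A 1 :: ('v, 'k::field) mvpoly set) \<longleftrightarrow>
    saturated_powers V A"
proof -
  let ?I = "\<lambda>n. monomial_power V A n :: ('v, 'k) mvpoly set"
  have "?I n = integral_closure (poly_ring V) (?I n) \<longleftrightarrow>
      (\<forall>m k. m \<in> exponents V \<longrightarrow> 1 \<le> k \<longrightarrow> scale k m \<in> sums_above V A (n * k) \<longrightarrow>
        m \<in> sums_above V A n)" (is "?closed \<longleftrightarrow> ?sat") for n
  proof
    assume ?closed
    show ?sat
    proof (intro allI impI)
      fix m and k :: nat
      assume "m \<in> exponents V" "1 \<le> k" "scale k m \<in> sums_above V A (n * k)"
      then have "Poly_Mapping.single m 1 \<in> ?I n"
        by (subst \<open>?closed\<close>) (rule monomial_in_integral_closure)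
      then show "m \<in> sums_above V A n" by (simp add: single_in_polys_on_iff)
    qed
  next
    assume ?sat
    have "x \<in> ?I n" if "x \<in> integral_closure (poly_ring V) (?I n)" for x
      using that \<open>?sat\<close> integral_over_saturated_power[OF fin A, of n x]
      unfolding integral_closure_poly_ring[OF ideal_monomial_power] ideals_set_pow_monomial_power
        carrier_poly_ring
      by blast
    then show ?closed
      using subset_integral_closure_monomial_power by blast
  qed
  then show ?thesis
    unfolding normal_ideal_def saturated_powers_def ideals_set_pow_monomial_power by auto
qed

section \<open>Ideals of covers\<close>

definition cover_exponents :: "('v, 'e) pre_digraph \<Rightarrow> ('v \<Rightarrow>\<^sub>0 nat) set" where
  "cover_exponents G = {\<Sum>t\<in>C. Poly_Mapping.single t 1 |C. minimal_vertex_cover G C}"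

lemma indicator_in_exponents: "C \<subseteq> V \<Longrightarrow> (\<Sum>t\<in>C. Poly_Mapping.single t 1) \<in> exponents V"
  by (induction C rule: infinite_finite_induct) auto

lemma prod_var: "(\<Prod>t\<in>C. var t) = Poly_Mapping.single (\<Sum>t\<in>C. Poly_Mapping.single t 1) 1"
  by (induction C rule: infinite_finite_induct) (simp_all add: var_def mult_single)

lemma minimal_vertex_cover_subset: "minimal_vertex_cover G C \<Longrightarrow> C \<subseteq> verts G"
  unfolding minimal_vertex_cover_def vertex_cover_def by blast

lemma cover_exponents_subset: "cover_exponents G \<subseteq> exponents (verts G)"
  unfolding cover_exponents_def
  using indicator_in_exponents minimal_vertex_cover_subset by blast

lemma finite_cover_exponents:
  assumes "finite (verts G)"
  shows "finite (cover_exponents G)"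
proof -
  have "cover_exponents G \<subseteq> (\<lambda>C. \<Sum>t\<in>C. Poly_Mapping.single t 1) ` Pow (verts G)"
    unfolding cover_exponents_def using minimal_vertex_cover_subset by blast
  then show ?thesis using assms by (simp add: finite_subset)
qed

lemma sums_above_generator: "a \<in> A \<Longrightarrow> a \<in> exponents V \<Longrightarrow> a \<in> sums_above V A 1"
  using sums_aboveI[of "{#a#}" A 1 0 V] by simp

lemma cover_ideal_eq_monomial_power:
  "cover_ideal G = (monomial_power (verts G) (cover_exponents G) 1 :: ('v, 'k::field) mvpoly set)"
    (is "_ = ?I")
proof -
  let ?R = "poly_ring (verts G) :: ('v, 'k) mvpoly ring"
  interpret R: cring ?R by (rule cring_poly_ring)
  have gens: "{\<Prod>t\<in>C. var t |C. minimal_vertex_cover G C} =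
      ((\<lambda>m. Poly_Mapping.single m 1) ` cover_exponents G :: ('v, 'k) mvpoly set)" (is "_ = ?S")
    unfolding cover_exponents_def prod_var by blast
  have S: "?S \<subseteq> carrier ?R"
    using cover_exponents_subset by (auto simp: carrier_poly_ring intro!: single_in_polys_on)
  interpret J: ideal "Idl\<^bsub>?R\<^esub> ?S" ?R using S by (rule R.genideal_ideal)
  have "Idl\<^bsub>?R\<^esub> ?S \<subseteq> ?I"
  proof (rule R.genideal_minimal[OF ideal_monomial_power])
    show "?S \<subseteq> ?I"
      using cover_exponents_subset[of G]
      by (blast intro: single_in_polys_on sums_above_generator)
  qed
  moreover have "p \<in> Idl\<^bsub>?R\<^esub> ?S" if "p \<in> ?I" for p
    using that
  proof (induction p rule: polys_on_induct)
    case zero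
    show ?case using J.zero_closed by simp
  next
    case (monomial m c)
    then obtain M s where M: "set_mset M \<subseteq> cover_exponents G" "size M = 1" "m = \<Sum>\<^sub># M + s"
        "s \<in> exponents (verts G)"
      by (rule sums_aboveE)
    then obtain g where g: "M = {#g#}" by (metis One_nat_def size_1_singleton_mset)
    have "Poly_Mapping.single g 1 \<in> Idl\<^bsub>?R\<^esub> ?S"
      using R.genideal_self[OF S] M(1) g by auto
    moreover have "Poly_Mapping.single s c \<in> carrier ?R"
      using M(4) by (simp add: carrier_poly_ring single_in_polys_on)
    ultimately show ?case
      using J.I_r_closed[of "Poly_Mapping.single g 1" "Poly_Mapping.single s c"] M(3) g
      by (simp add: mult_single)
  next
    case (add p q)
    then show ?case using J.a_closed[of p q] by simp
  qed
  ultimately show ?thesis unfolding cover_ideal_def gens by blast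
qed

section \<open>Covers of a graph and of a vertex-deleted subgraph\<close>

lemma vertex_cover_contains_minimal:
  assumes "finite (verts G)" "vertex_cover G C"
  obtains D where "D \<subseteq> C" "minimal_vertex_cover G D"
proof -
  have "finite C" using assms by (auto simp: vertex_cover_def intro: finite_subset)
  then have "\<exists>D\<subseteq>C. minimal_vertex_cover G D"
    using assms(2)
  proof (induction C rule: finite_psubset_induct)
    case (psubset C)
    show ?case
    proof (cases "minimal_vertex_cover G C")
      case False
      then obtain D where "D \<subset> C" "vertex_cover G D"
        using psubset.prems unfolding minimal_vertex_cover_def by blast
      then show ?thesis using psubset.IH[of D] by blast
    qed blast
  qed
  then show ?thesis using that by blast
qed

lemma vertex_cover_del_vert:
  assumes "vertex_cover G C"
  shows "vertex_cover (pre_digraph.del_vert G v) (C - {v})"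
  using assms unfolding vertex_cover_def by (auto simp: pre_digraph.del_vert_simps)

lemma vertex_cover_insert_deleted_vertex:
  assumes "vertex_cover (pre_digraph.del_vert G v) C" "v \<in> verts G"
  shows "vertex_cover G (insert v C)"
  using assms unfolding vertex_cover_def by (auto simp: pre_digraph.del_vert_simps)

lemma (in graph) neighbors_subset_cover:
  assumes "vertex_cover G C" "v \<notin> C"
  shows "neighbors G v \<subseteq> C"
proof
  fix u assume "u \<in> neighbors G v"
  then obtain e where "e \<in> arcs G" "tail G e = v" "head G e = u"
    by (auto simp: neighbors_def arcs_ends_conv)
  then show "u \<in> C" using assms unfolding vertex_cover_def by blast
qed

lemma (in graph) not_self_neighbor: "v \<notin> neighbors G v"
  using no_loops by (auto simp: neighbors_def arcs_ends_conv)

lemma minimal_vertex_coverD: "minimal_vertex_cover G C \<Longrightarrow> vertex_cover G C"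
  by (simp add: minimal_vertex_cover_def)

lemma minimal_vertex_cover_eqI:
  "minimal_vertex_cover G C \<Longrightarrow> vertex_cover G D \<Longrightarrow> D \<subseteq> C \<Longrightarrow> D = C"
  unfolding minimal_vertex_cover_def by blast

text \<open>
  Omitting \<open>v\<close> forces all its neighbours into the cover, whereas a cover that contains \<open>v\<close> has only
  the edges of the graph without \<open>v\<close> left to meet.
\<close>

lemma (in graph) minimal_cover_cases:
  assumes v: "v \<in> verts G" and N: "minimal_vertex_cover G (neighbors G v)"
    and C: "minimal_vertex_cover G C"
  shows "C = neighbors G v \<or>
    (v \<in> C \<and> minimal_vertex_cover (pre_digraph.del_vert G v) (C - {v}))"
proof (cases "v \<in> C")
  case False
  then have "neighbors G v \<subseteq> C"
    using C by (intro neighbors_subset_cover minimal_vertex_coverD)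
  then show ?thesis
    using minimal_vertex_cover_eqI[OF C minimal_vertex_coverD[OF N]] by blast
next
  case True
  have "\<not> vertex_cover (pre_digraph.del_vert G v) D" if "D \<subset> C - {v}" for D
  proof
    assume "vertex_cover (pre_digraph.del_vert G v) D"
    then have "vertex_cover G (insert v D)"
      using v by (rule vertex_cover_insert_deleted_vertex)
    then have "insert v D = C"
      using True that by (intro minimal_vertex_cover_eqI[OF C]) auto
    then show False using that by blast
  qed
  then show ?thesis
    using True vertex_cover_del_vert[OF minimal_vertex_coverD[OF C]]
    unfolding minimal_vertex_cover_def by blast
qed

text \<open>
  A cover properly contained in $D\cup\{v\}$ must omit \<open>v\<close> by minimality of \<open>D\<close>, so it contains the
  neighbours of \<open>v\<close> and they all lie in \<open>D\<close>. But they already cover the graph without \<open>v\<close>, and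
  minimality makes \<open>D\<close> equal to this set.
\<close>

lemma (in graph) minimal_cover_insert:
  assumes v: "v \<in> verts G" and N: "minimal_vertex_cover G (neighbors G v)"
    and D: "minimal_vertex_cover (pre_digraph.del_vert G v) D"
  shows "D = neighbors G v \<or> minimal_vertex_cover G (insert v D)"
proof (cases "D = neighbors G v")
  case False
  have cover: "vertex_cover G (insert v D)"
    using minimal_vertex_coverD[OF D] v by (rule vertex_cover_insert_deleted_vertex)
  have "\<not> vertex_cover G E" if E: "E \<subset> insert v D" for E
  proof
    assume E_cover: "vertex_cover G E"
    have "vertex_cover (pre_digraph.del_vert G v) (E - {v})"
      using E_cover by (rule vertex_cover_del_vert)
    then have D_eq: "E - {v} = D"
      using E by (intro minimal_vertex_cover_eqI[OF D]) auto
    with E have "v \<notin> E" by blast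
    then have "neighbors G v \<subseteq> D"
      using neighbors_subset_cover[OF E_cover] D_eq by auto
    moreover have "vertex_cover (pre_digraph.del_vert G v) (neighbors G v)"
      using vertex_cover_del_vert[OF minimal_vertex_coverD[OF N], of v] not_self_neighbor by simp
    ultimately show False
      using minimal_vertex_cover_eqI[OF D] False by blast
  qed
  then show ?thesis using cover unfolding minimal_vertex_cover_def by blast
qed simp

text \<open>
  This is $I_c(G)=vI_c(G\setminus v)+(f)$, where \<open>f\<close> is the product of the neighbours of \<open>v\<close>.
\<close>

lemma (in graph) adjoined_variable_cover_exponents:
  assumes v: "v \<in> verts G" and N: "minimal_vertex_cover G (neighbors G v)"
  shows "adjoined_variable (verts (pre_digraph.del_vert G v)) v
    (cover_exponents (pre_digraph.del_vert G v)) (cover_exponents G)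
    (\<Sum>t\<in>neighbors G v. Poly_Mapping.single t 1)"
proof
  let ?H = "pre_digraph.del_vert G v"
  let ?\<chi> = "\<lambda>C. \<Sum>t\<in>C. Poly_Mapping.single t 1 :: 'a \<Rightarrow>\<^sub>0 nat"
  have insert_verts: "insert v (verts ?H) = verts G"
    using v by (auto simp: pre_digraph.del_vert_simps)
  have fin: "finite C" if "C \<subseteq> verts G" for C using that by (rule finite_subset) simp
  have \<chi>_insert: "?\<chi> (insert v D) = ?\<chi> D + Poly_Mapping.single v 1" if "D \<subseteq> verts ?H" for D
    using that fin[of D] by (subst sum.insert) (auto simp: pre_digraph.del_vert_simps add.commute)
  show "v \<notin> verts ?H" by (simp add: pre_digraph.del_vert_simps)
  show "cover_exponents ?H \<subseteq> exponents (verts ?H)" by (rule cover_exponents_subset)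
  show N_in: "?\<chi> (neighbors G v) \<in> cover_exponents G"
    unfolding cover_exponents_def using N by blast
  show "?\<chi> (neighbors G v) \<in> sums_above (verts ?H) (cover_exponents ?H) 1"
  proof -
    have "vertex_cover ?H (neighbors G v)"
      using vertex_cover_del_vert[OF minimal_vertex_coverD[OF N], of v] not_self_neighbor by simp
    moreover have "finite (verts ?H)" by (simp add: pre_digraph.del_vert_simps)
    ultimately obtain D where D: "D \<subseteq> neighbors G v" "minimal_vertex_cover ?H D"
      by (metis vertex_cover_contains_minimal)
    have N_sub: "neighbors G v \<subseteq> verts ?H"
      using not_self_neighbor by (auto simp: pre_digraph.del_vert_simps neighbors_def)
    have "?\<chi> (neighbors G v) = ?\<chi> D + ?\<chi> (neighbors G v - D)"
      using D(1) fin[OF minimal_vertex_cover_subset[OF N]]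
      by (simp add: sum.subset_diff add.commute)
    moreover have "?\<chi> D \<in> sums_above (verts ?H) (cover_exponents ?H) 1"
      using D(2) cover_exponents_subset[of ?H]
      by (intro sums_above_generator) (auto simp: cover_exponents_def)
    moreover have "?\<chi> (neighbors G v - D) \<in> exponents (verts ?H)"
      using N_sub by (intro indicator_in_exponents) blast
    ultimately show ?thesis by (simp add: sums_above_upward_closed)
  qed
  show "g = ?\<chi> (neighbors G v) \<or> (\<exists>a\<in>cover_exponents ?H. g = a + Poly_Mapping.single v 1)"
    if g: "g \<in> cover_exponents G" for g
  proof -
    obtain C where C: "g = ?\<chi> C" "minimal_vertex_cover G C"
      using g unfolding cover_exponents_def by blast
    show ?thesis
    proof (cases "C = neighbors G v")
      case False
      then have vC: "v \<in> C" and D: "minimal_vertex_cover ?H (C - {v})"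
        using minimal_cover_cases[OF v N C(2)] by auto
      have "g = ?\<chi> (C - {v}) + Poly_Mapping.single v 1"
        using \<chi>_insert[OF minimal_vertex_cover_subset[OF D]] vC C(1) by (simp add: insert_absorb)
      then show ?thesis using D unfolding cover_exponents_def by blast
    qed (simp add: C)
  qed
  show "a + Poly_Mapping.single v 1 \<in> sums_above (insert v (verts ?H)) (cover_exponents G) 1"
    if a: "a \<in> cover_exponents ?H" for a
  proof -
    obtain D where D: "a = ?\<chi> D" "minimal_vertex_cover ?H D"
      using a unfolding cover_exponents_def by blast
    have generator: "g \<in> sums_above (verts G) (cover_exponents G) 1" if "g \<in> cover_exponents G" for g
      using that cover_exponents_subset by (intro sums_above_generator) blast+
    from minimal_cover_insert[OF v N D(2)] show ?thesis
    proof
      \<comment> \<open>In this case $D\cup\{v\}$ is not minimal, but its monomial is \<open>v\<close> times the generator \<open>f\<close>.\<close>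
      assume "D = neighbors G v"
      then show ?thesis
        using generator[OF N_in] v D(1)
        unfolding insert_verts by (simp add: sums_above_upward_closed)
    next
      assume "minimal_vertex_cover G (insert v D)"
      then have "?\<chi> (insert v D) \<in> cover_exponents G" unfolding cover_exponents_def by blast
      then show ?thesis
        using generator \<chi>_insert[OF minimal_vertex_cover_subset[OF D(2)]] D(1)
        unfolding insert_verts by simp
    qed
  qed
qed

theorem theorem5p2:
  fixes G :: "('v, 'e) pre_digraph" and v :: 'v
  assumes "graph G"
    and "v \<in> verts G"
    and "minimal_vertex_cover G (neighbors G v)"
  shows "normal_ideal (poly_ring (verts (pre_digraph.del_vert G v)))
           (cover_ideal (pre_digraph.del_vert G v) :: ('v, 'k::field) mvpoly set) \<longleftrightarrow>
         normal_ideal (poly_ring (verts G)) (cover_ideal G :: ('v, 'k) mvpoly set)"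
proof -
  interpret graph G by (rule assms(1))
  let ?H = "pre_digraph.del_vert G v"
  interpret adjoined_variable "verts ?H" v "cover_exponents ?H" "cover_exponents G"
    "\<Sum>t\<in>neighbors G v. Poly_Mapping.single t 1"
    using assms(2,3) by (rule adjoined_variable_cover_exponents)
  have "finite (verts ?H)" and insert_verts: "insert v (verts ?H) = verts G"
    using assms(2) by (auto simp: pre_digraph.del_vert_simps)
  then have "normal_ideal (poly_ring (verts ?H)) (cover_ideal ?H :: ('v, 'k) mvpoly set) \<longleftrightarrow>
      saturated_powers (verts ?H) (cover_exponents ?H)"
    unfolding cover_ideal_eq_monomial_power
    by (intro normal_monomial_ideal_iff finite_cover_exponents cover_exponents_subset)
  also have "\<dots> \<longleftrightarrow> saturated_powers (verts G) (cover_exponents G)"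
    using saturated_powers_iff unfolding insert_verts .
  also have "\<dots> \<longleftrightarrow> normal_ideal (poly_ring (verts G)) (cover_ideal G :: ('v, 'k) mvpoly set)"
    unfolding cover_ideal_eq_monomial_power
    by (intro normal_monomial_ideal_iff[symmetric] finite_cover_exponents cover_exponents_subset
        finite_verts)
  finally show ?thesis .
qed

end
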